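(* Let $p_1,\dots,p_n\in\mathbb{R}^d$, let $W\in\mathcal{S}^n$ be the Gram matrix $W_{ij}=p_i^\top p_j$, let $c_1,\dots,c_k$ be positive integers with $\sum_{j=1}^kc_j=n$, let $C=\mathrm{Diag}(c_1,\dots,c_k)$, and let $L_{=},L_{\neq}\subset[n]\times[n]$ be sets of must-link and cannot-link constraints. Consider the problem (A) in variables $X\in\mathbb{R}^{n\times k}$, $Z\in\mathcal{S}^n$: $$\min\ \mathrm{tr}(W-WZ)\quad\text{s.t.}\quad (X,Z)\in\mathcal{S}_{\mathrm{ML}}\cap\mathcal{ML}_{\mathrm{ML}}\cap\mathcal{CL}_{\mathrm{ML}},$$ and the problem (B) in variables $X^s\in\mathbb{R}^{m\times k}$, $Z^s\in\mathcal{S}^m$: $$\min\ \mathrm{tr}(W)-\mathrm{tr}\big(T^sW(T^s)^\top Z^s\big)$$ subject to - $X^s1_k=1_m$; - $(X^s)^\top e^s=\mathrm{diag}(C)$; - $X^s_{ih}+X^s_{jh}\le1$ for all $h\in[k]$, $(i,j)\in L^s_{\neq}$; - $Z^se^s=1_m$; - $\mathrm{diag}(Z^s)=X^s\,\mathrm{diag}(C^{-1})$; - $Z^s_{ij}=0$ for all $(i,j)\in L^s_{\neq}$; - $\begin{bmatrix} C & (X^s)^\top \\ X^s & Z^s \end{bmatrix}\succeq0$; - $X^s\ge0_{m\times k}$, $Z^s\ge0_{m\times m}$. Then problems (A) and (B) are equivalent, i.e. for every feasible solution of either problem there is a feasible solution of the other problem with the same objective value.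
   Context: $\mathcal{S}^n$ is the set of real symmetric $n\times n$ matrices; $\succeq$ is the positive semidefinite order; $\ge$ between matrices is elementwise; $1_n$ is the all-ones vector; $[n]=\{1,\dots,n\}$; $\mathrm{diag}(M)$ is the column vector of diagonal entries of $M$. $\mathcal{S}_{\mathrm{ML}}=\{(X,Z)\in\mathbb{R}^{n\times k}\times\mathcal{S}^n:\ X1_k=1_n,\ X^\top1_n=\mathrm{diag}(C),\ Z1_n=1_n,\ \mathrm{diag}(Z)=X\,\mathrm{diag}(C^{-1}),\ X\ge0,\ Z\ge0,\ Z\succeq XC^{-1}X^\top\}$. $\mathcal{ML}_{\mathrm{ML}}=\{(X,Z)\in\mathbb{R}^{n\times k}\times\mathcal{S}^n:\ X_{ih}=X_{jh}\ \forall h\in[k],\ Z_{ih}=Z_{jh}\ \forall h\in[n],\ \forall(i,j)\in L_{=}\}$. $\mathcal{CL}_{\mathrm{ML}}=\{(X,Z)\in\mathbb{R}^{n\times k}\times\mathcal{S}^n:\ X_{ih}+X_{jh}\le1\ \forall h\in[k],\ Z_{ij}=0,\ \forall(i,j)\in L_{\neq}\}$. Let $G$ be the undirected graph with vertex set $[n]$ and edge set $L_{=}$, and let $B_1,\dots,B_m\subseteq[n]$ ($m\le n$) be the vertex sets of its connected components. $T^s$ is the $m\times n$ matrix with $T^s_{ij}=1$ if $j\in B_i$ and $0$ otherwise; $e^s=T^s1_n\in\mathbb{R}^m$ is the vector of component sizes. $L^s_{\neq}\subset[m]\times[m]$ is the set of pairs $(i,j)$ such that there exist $p\in B_i$, $q\in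 B_j$ with $(p,q)\in L_{\neq}$. *)

theory Defs
  imports "Jordan_Normal_Form.Gauss_Jordan_Elimination"
begin

text \<open>
  Rows, columns and points are indexed from 0, so that \<open>[n]\<close> is \<open>{..<n}\<close>.  The relation \<open>\<le>\<close> on
  matrices is the elementwise order of the matrix library.
\<close>

subsection \<open>Matrices\<close>

definition ones_vec :: "nat \<Rightarrow> real vec" where
  "ones_vec n = vec n (\<lambda>_. 1)"

definition diag_vec :: "real mat \<Rightarrow> real vec" where
  "diag_vec M = vec (dim_row M) (\<lambda>i. M $$ (i, i))"

definition tr :: "real mat \<Rightarrow> real" where
  "tr M = (\<Sum>i<dim_row M. M $$ (i, i))"

definition sym_mats :: "nat \<Rightarrow> real mat set" where
  "sym_mats n = {M \<in> carrier_mat n n. M\<^sup>T = M}"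

definition psd :: "real mat \<Rightarrow> bool" where
  "psd M \<longleftrightarrow> M \<in> sym_mats (dim_row M) \<and>
     (\<forall>v \<in> carrier_vec (dim_row M). 0 \<le> v \<bullet> (M *\<^sub>v v))"

definition psd_ge :: "real mat \<Rightarrow> real mat \<Rightarrow> bool"  (infix "\<succeq>" 50) where
  "M \<succeq> N \<longleftrightarrow> psd (M - N)"

text \<open>The library's inverse is partial; it is only applied to invertible matrices below.\<close>

definition inv_mat :: "real mat \<Rightarrow> real mat" where
  "inv_mat M = the (mat_inverse M)"

definition gram_mat :: "nat \<Rightarrow> (nat \<Rightarrow> real vec) \<Rightarrow> real mat" where
  "gram_mat n p = mat n n (\<lambda>(i, j). p i \<bullet> p j)"

definition size_mat :: "nat \<Rightarrow> (nat \<Rightarrow> nat) \<Rightarrow> real mat" where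
  "size_mat k c = mat_diag k (\<lambda>j. real (c j))"

subsection \<open>The problem over the original points\<close>

definition assignment_set :: "nat \<Rightarrow> nat \<Rightarrow> real mat \<Rightarrow> (real mat \<times> real mat) set" where
  "assignment_set n k C = {(X, Z). X \<in> carrier_mat n k \<and> Z \<in> sym_mats n \<and>
     X *\<^sub>v ones_vec k = ones_vec n \<and>
     X\<^sup>T *\<^sub>v ones_vec n = diag_vec C \<and>
     Z *\<^sub>v ones_vec n = ones_vec n \<and>
     diag_vec Z = X *\<^sub>v diag_vec (inv_mat C) \<and>
     0\<^sub>m n k \<le> X \<and> 0\<^sub>m n n \<le> Z \<and>
     Z \<succeq> X * inv_mat C * X\<^sup>T}"

definition must_link_set :: "nat \<Rightarrow> nat \<Rightarrow> (nat \<times> nat) set \<Rightarrow> (real mat \<times> real mat) set" where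
  "must_link_set n k L = {(X, Z). X \<in> carrier_mat n k \<and> Z \<in> sym_mats n \<and>
     (\<forall>(i, j) \<in> L. (\<forall>h<k. X $$ (i, h) = X $$ (j, h)) \<and> (\<forall>h<n. Z $$ (i, h) = Z $$ (j, h)))}"

definition cannot_link_set :: "nat \<Rightarrow> nat \<Rightarrow> (nat \<times> nat) set \<Rightarrow> (real mat \<times> real mat) set" where
  "cannot_link_set n k L = {(X, Z). X \<in> carrier_mat n k \<and> Z \<in> sym_mats n \<and>
     (\<forall>(i, j) \<in> L. (\<forall>h<k. X $$ (i, h) + X $$ (j, h) \<le> 1) \<and> Z $$ (i, j) = 0)}"

definition feasible_A ::
  "nat \<Rightarrow> nat \<Rightarrow> real mat \<Rightarrow> (nat \<times> nat) set \<Rightarrow> (nat \<times> nat) set \<Rightarrow> (real mat \<times> real mat) set" where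
  "feasible_A n k C L_eq L_neq = assignment_set n k C \<inter> must_link_set n k L_eq \<inter> cannot_link_set n k L_neq"

definition objective_A :: "real mat \<Rightarrow> real mat \<Rightarrow> real" where
  "objective_A W Z = tr (W - W * Z)"

subsection \<open>The problem over the connected components\<close>

text \<open>
  Vertex sets of the connected components of the undirected graph on \<open>{..<n}\<close> with edge set \<open>L\<close>:
  the classes of vertices joined by a path.  Edges are given as ordered pairs, so \<open>L\<close> is
  symmetrised; loops have no effect.
\<close>

definition components :: "nat \<Rightarrow> (nat \<times> nat) set \<Rightarrow> nat set set" where
  "components n L = {..<n} // Restr ((L \<union> L\<inverse>)\<^sup>*) {..<n}"

definition T_mat :: "nat \<Rightarrow> nat \<Rightarrow> (nat \<Rightarrow> nat set) \<Rightarrow> real mat" where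
  "T_mat m n B = mat m n (\<lambda>(i, j). if j \<in> B i then 1 else 0)"

definition e_vec :: "nat \<Rightarrow> nat \<Rightarrow> (nat \<Rightarrow> nat set) \<Rightarrow> real vec" where
  "e_vec m n B = T_mat m n B *\<^sub>v ones_vec n"

definition L_shrunk :: "nat \<Rightarrow> (nat \<Rightarrow> nat set) \<Rightarrow> (nat \<times> nat) set \<Rightarrow> (nat \<times> nat) set" where
  "L_shrunk m B L = {(i, j). i < m \<and> j < m \<and> (\<exists>p \<in> B i. \<exists>q \<in> B j. (p, q) \<in> L)}"

text \<open>Here \<open>e\<close> is the vector of component sizes and \<open>L\<close> the set of shrunk cannot-link pairs.\<close>

definition feasible_B ::
  "nat \<Rightarrow> nat \<Rightarrow> real mat \<Rightarrow> real vec \<Rightarrow> (nat \<times> nat) set \<Rightarrow> (real mat \<times> real mat) set" where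
  "feasible_B m k C e L = {(X, Z). X \<in> carrier_mat m k \<and> Z \<in> sym_mats m \<and>
     X *\<^sub>v ones_vec k = ones_vec m \<and>
     X\<^sup>T *\<^sub>v e = diag_vec C \<and>
     (\<forall>h<k. \<forall>(i, j) \<in> L. X $$ (i, h) + X $$ (j, h) \<le> 1) \<and>
     Z *\<^sub>v e = ones_vec m \<and>
     diag_vec Z = X *\<^sub>v diag_vec (inv_mat C) \<and>
     (\<forall>(i, j) \<in> L. Z $$ (i, j) = 0) \<and>
     four_block_mat C X\<^sup>T X Z \<succeq> 0\<^sub>m (k + m) (k + m) \<and>
     0\<^sub>m m k \<le> X \<and> 0\<^sub>m m m \<le> Z}"

definition objective_B :: "real mat \<Rightarrow> real mat \<Rightarrow> real mat \<Rightarrow> real" where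
  "objective_B W T Z = tr W - tr (T * W * T\<^sup>T * Z)"

end

theory Submission
  imports Defs
begin

text \<open>
  Both problems describe the same pairs of matrices.  The must-link constraints force the rows of
  \<open>X\<close> and \<open>Z\<close>, hence also the columns of the symmetric matrix \<open>Z\<close>, to be constant on every connected
  component.  So \<open>X = T\<^sup>T X\<^sup>s\<close> and \<open>Z = T\<^sup>T Z\<^sup>s T\<close>, where \<open>X\<^sup>s\<close> and \<open>Z\<^sup>s\<close> are read off at one
  representative vertex per component; this is \<open>must_link_imp_expanded\<close>.

  It remains to see that an arbitrary pair \<open>(X\<^sup>s, Z\<^sup>s)\<close> is feasible for the component problem iff
  its expansion \<open>(T\<^sup>T X\<^sup>s, T\<^sup>T Z\<^sup>s T)\<close> is feasible for the original one (\<open>feasible_expand_iff\<close>), and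
  that the two objectives agree (\<open>objective_expand\<close>), which is the cyclicity of the trace.  The
  feasibility equivalence holds constraint by constraint.  The row sums, the diagonal condition, the
  signs and the cannot-link constraints only compare entries, and multiplication by \<open>T\<^sup>T\<close> on the
  left and by \<open>T\<close> on the right merely repeats entries.  The component sizes enter through
  \<open>T 1 = e\<close>.  For the semidefinite constraint, a Schur complement argument turns the block matrix
  into \<open>Z\<^sup>s - X\<^sup>s C\<inverse> X\<^sup>s\<^sup>T\<close>, and
  \<open>Z - X C\<inverse> X\<^sup>T = T\<^sup>T (Z\<^sup>s - X\<^sup>s C\<inverse> X\<^sup>s\<^sup>T) T\<close> is semidefinite iff its middle factor is, because \<open>T\<close> has a
  right inverse.
\<close>

section \<open>Semidefinite matrices\<close>

lemma psd_iff:
  assumes "M \<in> carrier_mat n n"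
  shows "psd M \<longleftrightarrow> M\<^sup>T = M \<and> (\<forall>v \<in> carrier_vec n. 0 \<le> v \<bullet> (M *\<^sub>v v))"
  using assms by (auto simp: psd_def sym_mats_def)

lemma transpose_congruence:
  fixes M :: "real mat"
  assumes M: "M \<in> carrier_mat m m" and S: "S \<in> carrier_mat m n"
  shows "(S\<^sup>T * M * S)\<^sup>T = S\<^sup>T * M\<^sup>T * S"
proof -
  have St: "S\<^sup>T \<in> carrier_mat n m" and Mt: "M\<^sup>T \<in> carrier_mat m m" using M S by auto
  have "(S\<^sup>T * M * S)\<^sup>T = S\<^sup>T * (S\<^sup>T * M)\<^sup>T"
    using M S by (intro transpose_mult[of _ n m]) auto
  also have "(S\<^sup>T * M)\<^sup>T = M\<^sup>T * S"
    using transpose_mult[OF St M] by simp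
  finally show ?thesis using assoc_mult_mat[OF St Mt S] by simp
qed

lemma psd_congruence:
  assumes M: "M \<in> carrier_mat m m" and S: "S \<in> carrier_mat m n" and psd: "psd M"
  shows "psd (S\<^sup>T * M * S)"
proof -
  have St: "S\<^sup>T \<in> carrier_mat n m" using S by simp
  have sym: "(S\<^sup>T * M * S)\<^sup>T = S\<^sup>T * M * S"
    using transpose_congruence[OF M S] psd by (simp add: psd_iff[OF M])
  have "0 \<le> v \<bullet> ((S\<^sup>T * M * S) *\<^sub>v v)" if v: "v \<in> carrier_vec n" for v
  proof -
    have Sv: "S *\<^sub>v v \<in> carrier_vec m" using S v by simp
    have MSv: "M *\<^sub>v (S *\<^sub>v v) \<in> carrier_vec m" using M Sv by simp
    have "(S\<^sup>T * M * S) *\<^sub>v v = S\<^sup>T *\<^sub>v (M *\<^sub>v (S *\<^sub>v v))"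
      using M S St Sv v
      by (simp add: assoc_mult_mat_vec[of _ n m _ n] assoc_mult_mat_vec[of _ n m _ m])
    then have "v \<bullet> ((S\<^sup>T * M * S) *\<^sub>v v) = (S *\<^sub>v v) \<bullet> (M *\<^sub>v (S *\<^sub>v v))"
      using transpose_vec_mult_scalar[OF St MSv v] by simp
    then show ?thesis using psd Sv by (simp add: psd_iff[OF M])
  qed
  then show ?thesis using sym M S St by (subst psd_iff[of _ n]) auto
qed

text \<open>
  Congruence by a matrix of full row rank loses no information.  This is why both symmetry and
  semidefiniteness can be pulled back from the expanded matrix to the component matrix.
\<close>

lemma congruence_right_inverse:
  fixes M :: "real mat"
  assumes "M \<in> carrier_mat m m" "T \<in> carrier_mat m n" "R \<in> carrier_mat n m" "T * R = 1\<^sub>m m"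
  shows "R\<^sup>T * (T\<^sup>T * M * T) * R = M"
proof -
  have RT: "R\<^sup>T * T\<^sup>T = 1\<^sub>m m"
    using assms transpose_mult[of T m n R m] by simp
  have carr: "R\<^sup>T \<in> carrier_mat m n" "T\<^sup>T \<in> carrier_mat n m" using assms by auto
  have "R\<^sup>T * (T\<^sup>T * M * T) * R = R\<^sup>T * (T\<^sup>T * (M * (T * R)))"
    using assms(1-3) carr
    by (simp add: assoc_mult_mat[of _ m n _ n _ m] assoc_mult_mat[of _ n m _ m _ n]
        assoc_mult_mat[of _ n m _ n _ m] assoc_mult_mat[of _ m m _ n _ m])
  also have "\<dots> = (R\<^sup>T * T\<^sup>T) * M"
    using assms carr by (simp add: assoc_mult_mat[of _ m n _ m _ m])
  finally show ?thesis using RT assms by simp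
qed

lemma psd_congruence_iff:
  assumes "M \<in> carrier_mat m m" "T \<in> carrier_mat m n" "R \<in> carrier_mat n m" "T * R = 1\<^sub>m m"
  shows "psd (T\<^sup>T * M * T) \<longleftrightarrow> psd M"
proof
  assume "psd (T\<^sup>T * M * T)"
  moreover have "T\<^sup>T * M * T \<in> carrier_mat n n" using assms by auto
  ultimately have "psd (R\<^sup>T * (T\<^sup>T * M * T) * R)"
    using assms(3) by (rule psd_congruence[rotated 2])
  then show "psd M" by (simp add: congruence_right_inverse[OF assms])
qed (use psd_congruence assms in blast)

lemma inverse_symmetric:
  fixes C D :: "real mat"
  assumes C: "C \<in> carrier_mat k k" "C\<^sup>T = C" and D: "D \<in> carrier_mat k k" "C * D = 1\<^sub>m k"
  shows "D\<^sup>T = D"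
proof -
  have DtC: "D\<^sup>T * C = 1\<^sub>m k"
    using transpose_mult[OF C(1) D(1)] C D by simp
  have "D\<^sup>T = D\<^sup>T * (C * D)" using D by simp
  also have "\<dots> = (D\<^sup>T * C) * D"
    using C(1) D(1) by (intro assoc_mult_mat[symmetric, of _ k k _ k _ k]) auto
  finally show ?thesis using DtC D by simp
qed

text \<open>
  Completing the square in \<open>u\<close>: the cross terms \<open>2 u \<bullet> X\<^sup>T w\<close> are absorbed into the square of the
  shifted vector \<open>z\<close>, at the cost of the term \<open>w \<bullet> X D X\<^sup>T w\<close>.
\<close>

lemma block_quadratic_form:
  fixes C D X Z :: "real mat"
  assumes C: "C \<in> carrier_mat k k" "C\<^sup>T = C" and D: "D \<in> carrier_mat k k" "C * D = 1\<^sub>m k"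
    and X: "X \<in> carrier_mat m k" and Z: "Z \<in> carrier_mat m m"
    and u: "u \<in> carrier_vec k" and w: "w \<in> carrier_vec m"
  defines "z \<equiv> u + D *\<^sub>v (X\<^sup>T *\<^sub>v w)"
  shows "(u @\<^sub>v w) \<bullet> (four_block_mat C X\<^sup>T X Z *\<^sub>v (u @\<^sub>v w))
    = z \<bullet> (C *\<^sub>v z) + w \<bullet> ((Z - X * D * X\<^sup>T) *\<^sub>v w)"
proof -
  define y where "y = X\<^sup>T *\<^sub>v w"
  define x where "x = D *\<^sub>v y"
  have Xt: "X\<^sup>T \<in> carrier_mat k m" using X by simp
  have y: "y \<in> carrier_vec k" using Xt w by (simp add: y_def)
  have x: "x \<in> carrier_vec k" using D y by (simp add: x_def)
  have z: "z = u + x" by (simp add: z_def x_def y_def)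
  have Cx: "C *\<^sub>v x = y"
    using assoc_mult_mat_vec[OF C(1) D(1) y] D y by (simp add: x_def)
  have Cu: "C *\<^sub>v u \<in> carrier_vec k" using C u by simp
  have Xu: "X *\<^sub>v u \<in> carrier_vec m" using X u by simp
  have Zw: "Z *\<^sub>v w \<in> carrier_vec m" using Z w by simp
  have Xx: "X *\<^sub>v x \<in> carrier_vec m" using X x by simp
  have "four_block_mat C X\<^sup>T X Z *\<^sub>v (u @\<^sub>v w) = (C *\<^sub>v u + y) @\<^sub>v (X *\<^sub>v u + Z *\<^sub>v w)"
    unfolding y_def by (rule four_block_mat_mult_vec[OF C(1) Xt X Z u w])
  then have "(u @\<^sub>v w) \<bullet> (four_block_mat C X\<^sup>T X Z *\<^sub>v (u @\<^sub>v w))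
      = u \<bullet> (C *\<^sub>v u + y) + w \<bullet> (X *\<^sub>v u + Z *\<^sub>v w)"
    using u w y Cu Xu Zw by (simp add: scalar_prod_append[of _ k _ m])
  also have "\<dots> = u \<bullet> (C *\<^sub>v u) + u \<bullet> y + (y \<bullet> u + w \<bullet> (Z *\<^sub>v w))"
    using u w y Cu Xu Zw transpose_vec_mult_scalar[OF X u w]
    by (simp add: scalar_prod_add_distrib[of _ k] scalar_prod_add_distrib[of _ m] y_def)
  finally have lhs: "(u @\<^sub>v w) \<bullet> (four_block_mat C X\<^sup>T X Z *\<^sub>v (u @\<^sub>v w))
      = u \<bullet> (C *\<^sub>v u) + u \<bullet> y + (y \<bullet> u + w \<bullet> (Z *\<^sub>v w))" .
  have "x \<bullet> (C *\<^sub>v u) = y \<bullet> u"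
    using transpose_vec_mult_scalar[OF C(1) u x] C Cx by simp
  moreover have "z \<bullet> (C *\<^sub>v z) = (u + x) \<bullet> (C *\<^sub>v u + y)"
    using C u x by (simp add: z mult_add_distrib_mat_vec[of _ k k] Cx)
  ultimately have square: "z \<bullet> (C *\<^sub>v z) = u \<bullet> (C *\<^sub>v u) + u \<bullet> y + (y \<bullet> u + x \<bullet> y)"
    using u x y Cu by (simp add: add_scalar_prod_distrib[of _ k] scalar_prod_add_distrib[of _ k])
  have "(X * D * X\<^sup>T) *\<^sub>v w = X *\<^sub>v x"
    using X Xt D w y by (simp add: assoc_mult_mat_vec[of _ m k _ m] assoc_mult_mat_vec[of _ m k _ k]
        x_def y_def)
  moreover have "(Z - X * D * X\<^sup>T) *\<^sub>v w = Z *\<^sub>v w - (X * D * X\<^sup>T) *\<^sub>v w"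
    by (rule minus_mult_distrib_mat_vec[of _ m m]) (use X Xt D Z w in auto)
  ultimately have "w \<bullet> ((Z - X * D * X\<^sup>T) *\<^sub>v w) = w \<bullet> (Z *\<^sub>v w) - w \<bullet> (X *\<^sub>v x)"
    using w Zw Xx by (simp add: scalar_prod_minus_distrib[of _ m])
  also have "w \<bullet> (X *\<^sub>v x) = x \<bullet> y"
    using transpose_vec_mult_scalar[OF X x w] comm_scalar_prod[OF x y] by (simp add: y_def)
  finally show ?thesis using lhs square by simp
qed

text \<open>
  As \<open>u\<close> ranges over all vectors, so does the shifted vector in the completed square.  The square is
  nonnegative because \<open>C\<close> is semidefinite, and it can be made zero for any given \<open>w\<close>, which leaves
  exactly the form of the Schur complement.
\<close>

lemma psd_block_iff_schur_complement:
  fixes C D X Z :: "real mat"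
  assumes C: "C \<in> carrier_mat k k" "psd C" and D: "D \<in> carrier_mat k k" "C * D = 1\<^sub>m k"
    and X: "X \<in> carrier_mat m k" and Z: "Z \<in> carrier_mat m m" "Z\<^sup>T = Z"
  shows "psd (four_block_mat C X\<^sup>T X Z) \<longleftrightarrow> psd (Z - X * D * X\<^sup>T)"
proof -
  let ?F = "four_block_mat C X\<^sup>T X Z" and ?S = "Z - X * D * X\<^sup>T"
  have Csym: "C\<^sup>T = C" using C psd_iff by blast
  have Xt: "X\<^sup>T \<in> carrier_mat k m" using X by simp
  have Dsym: "D\<^sup>T = D" by (rule inverse_symmetric[OF C(1) Csym D])
  have F: "?F \<in> carrier_mat (k + m) (k + m)" using C Z by auto
  have S: "?S \<in> carrier_mat m m" using X by auto
  have Fsym: "?F\<^sup>T = ?F"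
    by (simp add: transpose_four_block_mat[OF C(1) Xt X Z(1)] Csym Z(2))
  have "(X * D * X\<^sup>T)\<^sup>T = X * D * X\<^sup>T"
    using transpose_congruence[OF D(1) Xt] Dsym by simp
  then have Ssym: "?S\<^sup>T = ?S"
    using X Xt D Z by (subst transpose_minus[of _ m m]) auto
  note form = block_quadratic_form[OF C(1) Csym D X Z(1)]
  have "(\<forall>v \<in> carrier_vec (k + m). 0 \<le> v \<bullet> (?F *\<^sub>v v)) \<longleftrightarrow>
    (\<forall>w \<in> carrier_vec m. 0 \<le> w \<bullet> (?S *\<^sub>v w))"
  proof safe
    fix w :: "real vec" assume w: "w \<in> carrier_vec m"
      and F_nonneg: "\<forall>v \<in> carrier_vec (k + m). 0 \<le> v \<bullet> (?F *\<^sub>v v)"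
    \<comment> \<open>this choice makes the square vanish\<close>
    define u where "u = - (D *\<^sub>v (X\<^sup>T *\<^sub>v w))"
    have x: "D *\<^sub>v (X\<^sup>T *\<^sub>v w) \<in> carrier_vec k" using D Xt w by simp
    have u: "u \<in> carrier_vec k" using x by (simp add: u_def)
    have "u + D *\<^sub>v (X\<^sup>T *\<^sub>v w) = 0\<^sub>v k" using x by (simp add: u_def)
    moreover have "0\<^sub>v k \<bullet> (C *\<^sub>v 0\<^sub>v k) = 0" using C(1) by simp
    ultimately have "(u @\<^sub>v w) \<bullet> (?F *\<^sub>v (u @\<^sub>v w)) = w \<bullet> (?S *\<^sub>v w)"
      using form[OF u w] by simp
    moreover have "u @\<^sub>v w \<in> carrier_vec (k + m)" using u w by simp
    ultimately show "0 \<le> w \<bullet> (?S *\<^sub>v w)" using F_nonneg by metis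
  next
    fix v :: "real vec" assume v: "v \<in> carrier_vec (k + m)"
      and S_nonneg: "\<forall>w \<in> carrier_vec m. 0 \<le> w \<bullet> (?S *\<^sub>v w)"
    define u where "u = vec_first v k"
    define w where "w = vec_last v m"
    have u: "u \<in> carrier_vec k" and w: "w \<in> carrier_vec m" by (auto simp: u_def w_def)
    have v_split: "v = u @\<^sub>v w" using v by (simp add: u_def w_def)
    have "u + D *\<^sub>v (X\<^sup>T *\<^sub>v w) \<in> carrier_vec k" using u D Xt w by simp
    then show "0 \<le> v \<bullet> (?F *\<^sub>v v)"
      using C S_nonneg w unfolding v_split form[OF u w] by (simp add: psd_iff)
  qed
  then show ?thesis using Fsym Ssym by (simp add: psd_iff[OF F] psd_iff[OF S])
qed

section \<open>The diagonal matrix of cluster sizes\<close>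

lemma size_mat_carrier [simp]: "size_mat k c \<in> carrier_mat k k"
  by (simp add: size_mat_def)

lemma inv_mat_unique:
  assumes C: "C \<in> carrier_mat k k" and D: "D \<in> carrier_mat k k" "C * D = 1\<^sub>m k" "D * C = 1\<^sub>m k"
  shows "inv_mat C \<in> carrier_mat k k" "C * inv_mat C = 1\<^sub>m k"
proof -
  have "C \<in> Units (ring_mat TYPE(real) k undefined)"
    using C D by (auto simp: Units_def ring_mat_def)
  then obtain E where "mat_inverse C = Some E"
    using mat_inverse(1)[OF C, where b = undefined] by (cases "mat_inverse C") blast+
  then show "inv_mat C \<in> carrier_mat k k" "C * inv_mat C = 1\<^sub>m k"
    using mat_inverse(2)[OF C] by (auto simp: inv_mat_def)
qed

lemma inv_size_mat:
  assumes "\<And>j. j < k \<Longrightarrow> 0 < c j"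
  shows "inv_mat (size_mat k c) \<in> carrier_mat k k" "size_mat k c * inv_mat (size_mat k c) = 1\<^sub>m k"
proof -
  have "mat_diag k (\<lambda>j. real (c j) * (1 / real (c j))) = 1\<^sub>m k"
    using assms by (intro eq_matI) (fastforce simp: mat_diag_def)+
  then have "size_mat k c * mat_diag k (\<lambda>j. 1 / real (c j)) = 1\<^sub>m k"
    "mat_diag k (\<lambda>j. 1 / real (c j)) * size_mat k c = 1\<^sub>m k"
    by (simp_all add: size_mat_def mult.commute)
  note inv = inv_mat_unique[OF size_mat_carrier mat_diag_dim this]
  show "inv_mat (size_mat k c) \<in> carrier_mat k k" "size_mat k c * inv_mat (size_mat k c) = 1\<^sub>m k"
    by (fact inv)+
qed

lemma psd_size_mat: "psd (size_mat k c)"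
proof -
  have "0 \<le> v \<bullet> (size_mat k c *\<^sub>v v)" if v: "v \<in> carrier_vec k" for v
  proof -
    have "size_mat k c *\<^sub>v v = vec k (\<lambda>i. real (c i) * v $ i)"
      using v by (intro eq_vecI) (auto simp: size_mat_def mat_diag_def scalar_prod_def
          if_distrib[of "\<lambda>x. x * _"] cong: if_cong)
    then have "v \<bullet> (size_mat k c *\<^sub>v v) = (\<Sum>i<k. v $ i * (real (c i) * v $ i))"
      by (simp add: scalar_prod_def atLeast0LessThan)
    also have "\<dots> = (\<Sum>i<k. real (c i) * (v $ i)\<^sup>2)"
      by (intro sum.cong) (simp_all add: power2_eq_square)
    finally have "v \<bullet> (size_mat k c *\<^sub>v v) = (\<Sum>i<k. real (c i) * (v $ i)\<^sup>2)" .
    then show ?thesis by (simp add: sum_nonneg)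
  qed
  moreover have "(size_mat k c)\<^sup>T = size_mat k c"
    by (rule eq_matI) (auto simp: size_mat_def mat_diag_def)
  ultimately show ?thesis by (simp add: psd_iff[OF size_mat_carrier])
qed

section \<open>Expanding component matrices\<close>

lemma tr_mult_commute:
  assumes "A \<in> carrier_mat n m" "B \<in> carrier_mat m n"
  shows "tr (A * B) = tr (B * A)"
proof -
  have "tr (A * B) = (\<Sum>i<n. \<Sum>j<m. A $$ (i, j) * B $$ (j, i))"
    using assms by (simp add: tr_def scalar_prod_def atLeast0LessThan)
  also have "\<dots> = (\<Sum>j<m. \<Sum>i<n. B $$ (j, i) * A $$ (i, j))"
    by (subst sum.swap) (simp add: mult.commute)
  also have "\<dots> = tr (B * A)"
    using assms by (simp add: tr_def scalar_prod_def atLeast0LessThan)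
  finally show ?thesis .
qed

text \<open>
  A partition of \<open>{..<n}\<close> into nonempty classes, given with its quotient map \<open>b\<close> and a section \<open>r\<close>
  of it.  In these terms multiplication by \<open>T\<^sup>T\<close> and \<open>T\<close> is reindexing along \<open>b\<close>, and evaluation at
  the representatives \<open>r\<close> undoes it.
\<close>

locale indexed_partition =
  fixes n m :: nat and B :: "nat \<Rightarrow> nat set" and b r :: "nat \<Rightarrow> nat"
  assumes class_less: "j < n \<Longrightarrow> b j < m"
    and mem_class_iff: "i < m \<Longrightarrow> j \<in> B i \<longleftrightarrow> j < n \<and> b j = i"
    and rep_less: "i < m \<Longrightarrow> r i < n"
    and class_rep: "i < m \<Longrightarrow> b (r i) = i"
begin

abbreviation "T \<equiv> T_mat m n B"

lemma T_carrier [simp]: "T \<in> carrier_mat m n" "T\<^sup>T \<in> carrier_mat n m"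
  by (auto simp: T_mat_def)

lemma T_dim [simp]: "dim_row T = m" "dim_col T = n"
  by (simp_all add: T_mat_def)

lemma T_entry: "i < m \<Longrightarrow> j < n \<Longrightarrow> T $$ (i, j) = (if b j = i then 1 else 0)"
  by (simp add: T_mat_def mem_class_iff)

lemma T_transpose_mult_entry:
  assumes "A \<in> carrier_mat m q" "j < n" "h < q"
  shows "(T\<^sup>T * A) $$ (j, h) = A $$ (b j, h)"
  using assms class_less
  by (simp add: scalar_prod_def T_entry if_distrib[of "\<lambda>x. x * _"] cong: if_cong)

lemma mult_T_entry:
  assumes "A \<in> carrier_mat q m" "i < q" "j < n"
  shows "(A * T) $$ (i, j) = A $$ (i, b j)"
  using assms class_less
  by (simp add: scalar_prod_def T_entry if_distrib[of "\<lambda>x. _ * x"] cong: if_cong)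

lemma T_transpose_mult_vec_entry:
  assumes "v \<in> carrier_vec m" "j < n"
  shows "(T\<^sup>T *\<^sub>v v) $ j = v $ b j"
  using assms class_less
  by (simp add: scalar_prod_def T_entry if_distrib[of "\<lambda>x. x * _"] cong: if_cong)

lemma congruence_entry:
  assumes "Z \<in> carrier_mat m m" "i < n" "j < n"
  shows "(T\<^sup>T * Z * T) $$ (i, j) = Z $$ (b i, b j)"
proof -
  have "T\<^sup>T * Z \<in> carrier_mat n m" using assms by auto
  then show ?thesis
    using assms class_less by (simp add: mult_T_entry[of _ n] T_transpose_mult_entry[of _ m]
        del: index_mult_mat)
qed

lemma T_transpose_mult_vec_inj:
  assumes "v \<in> carrier_vec m" "w \<in> carrier_vec m"
  shows "T\<^sup>T *\<^sub>v v = T\<^sup>T *\<^sub>v w \<longleftrightarrow> v = w"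
proof
  assume eq: "T\<^sup>T *\<^sub>v v = T\<^sup>T *\<^sub>v w"
  have "v $ i = w $ i" if "i < m" for i
    using arg_cong[OF eq, of "\<lambda>x. x $ r i"] assms that
    by (simp add: T_transpose_mult_vec_entry rep_less class_rep del: index_mult_mat_vec)
  then show "v = w" using assms by auto
qed simp

lemma T_transpose_mult_ones: "T\<^sup>T *\<^sub>v ones_vec m = ones_vec n"
proof (rule eq_vecI)
  fix j assume "j < dim_vec (ones_vec n)"
  then have "j < n" by (simp add: ones_vec_def)
  then show "(T\<^sup>T *\<^sub>v ones_vec m) $ j = ones_vec n $ j"
    using class_less by (subst T_transpose_mult_vec_entry) (auto simp: ones_vec_def)
qed (simp add: ones_vec_def)

lemma T_right_inverse:
  obtains R where "R \<in> carrier_mat n m" "T * R = 1\<^sub>m m"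
proof
  define R where "R = mat n m (\<lambda>(j, i). if j = r i then 1 else 0 :: real)"
  show "R \<in> carrier_mat n m" by (simp add: R_def)
  show "T * R = 1\<^sub>m m"
  proof (rule eq_matI)
    fix i j assume "i < dim_row (1\<^sub>m m :: real mat)" "j < dim_col (1\<^sub>m m :: real mat)"
    then have ij: "i < m" "j < m" by auto
    then have "(T * R) $$ (i, j) = T $$ (i, r j)"
      using rep_less
      by (simp add: R_def scalar_prod_def if_distrib[of "\<lambda>x. _ * x"] cong: if_cong)
    then show "(T * R) $$ (i, j) = 1\<^sub>m m $$ (i, j)"
      using ij by (simp add: T_entry rep_less class_rep)
  qed (simp_all add: R_def)
qed

lemma row_sums_expand_iff:
  assumes "X \<in> carrier_mat m k"
  shows "(T\<^sup>T * X) *\<^sub>v ones_vec k = ones_vec n \<longleftrightarrow> X *\<^sub>v ones_vec k = ones_vec m"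
proof -
  have ones: "ones_vec k \<in> carrier_vec k" "ones_vec m \<in> carrier_vec m" by (auto simp: ones_vec_def)
  have "(T\<^sup>T * X) *\<^sub>v ones_vec k = T\<^sup>T *\<^sub>v (X *\<^sub>v ones_vec k)"
    using assms ones by (simp add: assoc_mult_mat_vec[of _ n m _ k])
  then show ?thesis
    using assms ones T_transpose_mult_vec_inj[of "X *\<^sub>v ones_vec k" "ones_vec m"]
    by (simp add: T_transpose_mult_ones)
qed

lemma column_sums_expand:
  assumes "X \<in> carrier_mat m k"
  shows "(T\<^sup>T * X)\<^sup>T *\<^sub>v ones_vec n = X\<^sup>T *\<^sub>v e_vec m n B"
proof -
  have "(T\<^sup>T * X)\<^sup>T = X\<^sup>T * T"
    using assms by (simp add: transpose_mult[of _ n m _ k])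
  then show ?thesis
    using assms by (simp add: e_vec_def assoc_mult_mat_vec[of _ k m _ n] ones_vec_def)
qed

lemma congruence_row_sums_expand_iff:
  assumes Z: "Z \<in> carrier_mat m m"
  shows "(T\<^sup>T * Z * T) *\<^sub>v ones_vec n = ones_vec n \<longleftrightarrow> Z *\<^sub>v e_vec m n B = ones_vec m"
proof -
  have ones: "ones_vec n \<in> carrier_vec n" "ones_vec m \<in> carrier_vec m" by (auto simp: ones_vec_def)
  have e: "e_vec m n B \<in> carrier_vec m"
    unfolding e_vec_def by (rule mult_mat_vec_carrier[OF T_carrier(1) ones(1)])
  have "T\<^sup>T * Z \<in> carrier_mat n m" using Z by auto
  then have "(T\<^sup>T * Z * T) *\<^sub>v ones_vec n = T\<^sup>T *\<^sub>v (Z *\<^sub>v e_vec m n B)"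
    using assoc_mult_mat_vec[OF _ T_carrier(1) ones(1)] assoc_mult_mat_vec[OF T_carrier(2) Z e]
    by (simp add: e_vec_def)
  then show ?thesis
    using Z e ones T_transpose_mult_vec_inj[of "Z *\<^sub>v e_vec m n B" "ones_vec m"]
    by (simp add: T_transpose_mult_ones)
qed

lemma diagonal_expand_iff:
  assumes X: "X \<in> carrier_mat m k" and Z: "Z \<in> carrier_mat m m" and v: "v \<in> carrier_vec k"
  shows "diag_vec (T\<^sup>T * Z * T) = (T\<^sup>T * X) *\<^sub>v v \<longleftrightarrow> diag_vec Z = X *\<^sub>v v"
proof -
  have d: "diag_vec Z \<in> carrier_vec m" using Z by (simp add: diag_vec_def)
  have "diag_vec (T\<^sup>T * Z * T) = T\<^sup>T *\<^sub>v diag_vec Z"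
  proof (rule eq_vecI)
    fix j assume "j < dim_vec (T\<^sup>T *\<^sub>v diag_vec Z)"
    then have j: "j < n" by simp
    then have "diag_vec (T\<^sup>T * Z * T) $ j = Z $$ (b j, b j)"
      using Z by (simp add: diag_vec_def congruence_entry del: index_mult_mat(1))
    moreover have "(T\<^sup>T *\<^sub>v diag_vec Z) $ j = diag_vec Z $ b j"
      by (rule T_transpose_mult_vec_entry[OF d j])
    moreover have "diag_vec Z $ b j = Z $$ (b j, b j)"
      using Z class_less[OF j] by (simp add: diag_vec_def)
    ultimately show "diag_vec (T\<^sup>T * Z * T) $ j = (T\<^sup>T *\<^sub>v diag_vec Z) $ j" by simp
  qed (simp add: diag_vec_def)
  moreover have "(T\<^sup>T * X) *\<^sub>v v = T\<^sup>T *\<^sub>v (X *\<^sub>v v)"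
    using X v by (simp add: assoc_mult_mat_vec[of _ n m _ k])
  ultimately show ?thesis
    using X v d T_transpose_mult_vec_inj[of "diag_vec Z" "X *\<^sub>v v"] by simp
qed

lemma nonneg_expand_iff:
  assumes X: "X \<in> carrier_mat m k"
  shows "0\<^sub>m n k \<le> T\<^sup>T * X \<longleftrightarrow> 0\<^sub>m m k \<le> X"
proof -
  have "0\<^sub>m n k \<le> T\<^sup>T * X \<longleftrightarrow> (\<forall>j<n. \<forall>h<k. 0 \<le> X $$ (b j, h))"
    using X by (auto simp: less_eq_mat_def T_transpose_mult_entry[OF X] simp del: index_mult_mat(1))
  moreover have "0\<^sub>m m k \<le> X \<longleftrightarrow> (\<forall>i<m. \<forall>h<k. 0 \<le> X $$ (i, h))"
    using X by (auto simp: less_eq_mat_def)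
  ultimately show ?thesis using class_less rep_less class_rep by metis
qed

lemma nonneg_congruence_iff:
  assumes Z: "Z \<in> carrier_mat m m"
  shows "0\<^sub>m n n \<le> T\<^sup>T * Z * T \<longleftrightarrow> 0\<^sub>m m m \<le> Z"
proof -
  have "0\<^sub>m n n \<le> T\<^sup>T * Z * T \<longleftrightarrow> (\<forall>i<n. \<forall>j<n. 0 \<le> Z $$ (b i, b j))"
    using Z by (auto simp: less_eq_mat_def congruence_entry[OF Z] simp del: index_mult_mat(1))
  moreover have "0\<^sub>m m m \<le> Z \<longleftrightarrow> (\<forall>i<m. \<forall>j<m. 0 \<le> Z $$ (i, j))"
    using Z by (auto simp: less_eq_mat_def)
  ultimately show ?thesis using class_less rep_less class_rep by metis
qed

lemma symmetric_congruence_iff: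
  assumes Z: "Z \<in> carrier_mat m m"
  shows "T\<^sup>T * Z * T \<in> sym_mats n \<longleftrightarrow> Z \<in> sym_mats m"
proof -
  have "(T\<^sup>T * Z * T)\<^sup>T = T\<^sup>T * Z\<^sup>T * T"
    by (rule transpose_congruence[OF Z T_carrier(1)])
  moreover obtain R where R: "R \<in> carrier_mat n m" "T * R = 1\<^sub>m m" by (rule T_right_inverse)
  have "T\<^sup>T * Z\<^sup>T * T = T\<^sup>T * Z * T \<longleftrightarrow> Z\<^sup>T = Z"
    using congruence_right_inverse[OF _ T_carrier(1) R, of Z]
      congruence_right_inverse[OF _ T_carrier(1) R, of "Z\<^sup>T"] Z by (metis transpose_carrier_mat)
  ultimately show ?thesis using Z by (auto simp: sym_mats_def)
qed

text \<open>
  Both terms of the Schur complement carry the outer factors \<open>T\<^sup>T\<close> and \<open>T\<close>, so the whole Schur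
  complement of the expanded pair is a congruence of the one of the component pair.
\<close>

lemma psd_expand_iff:
  assumes X: "X \<in> carrier_mat m k" and Z: "Z \<in> carrier_mat m m" and D: "D \<in> carrier_mat k k"
  shows "psd (T\<^sup>T * Z * T - (T\<^sup>T * X) * D * (T\<^sup>T * X)\<^sup>T) \<longleftrightarrow> psd (Z - X * D * X\<^sup>T)"
proof -
  have XD: "X * D \<in> carrier_mat m k" using X D by simp
  have Xt: "X\<^sup>T \<in> carrier_mat k m" using X by simp
  have XDX: "X * D * X\<^sup>T \<in> carrier_mat m m" using XD Xt by simp
  have "(T\<^sup>T * X) * D * (T\<^sup>T * X)\<^sup>T = (T\<^sup>T * (X * D)) * (X\<^sup>T * T)"
    using X D by (simp add: transpose_mult[of _ n m _ k] assoc_mult_mat[of _ n m _ k _ k])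
  also have "\<dots> = T\<^sup>T * ((X * D) * (X\<^sup>T * T))"
    by (rule assoc_mult_mat[OF T_carrier(2) XD]) (use Xt in auto)
  also have "\<dots> = T\<^sup>T * ((X * D * X\<^sup>T) * T)"
    by (simp add: assoc_mult_mat[OF XD Xt T_carrier(1)])
  also have "\<dots> = T\<^sup>T * (X * D * X\<^sup>T) * T"
    by (rule assoc_mult_mat[OF T_carrier(2) XDX T_carrier(1), symmetric])
  finally have "T\<^sup>T * Z * T - (T\<^sup>T * X) * D * (T\<^sup>T * X)\<^sup>T
      = T\<^sup>T * Z * T - T\<^sup>T * (X * D * X\<^sup>T) * T" by simp
  also have "\<dots> = (T\<^sup>T * Z - T\<^sup>T * (X * D * X\<^sup>T)) * T"
    by (rule minus_mult_distrib_mat[OF _ _ T_carrier(1), symmetric])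
      (rule mult_carrier_mat[OF T_carrier(2)], fact)+
  also have "\<dots> = T\<^sup>T * (Z - X * D * X\<^sup>T) * T"
    by (simp add: mult_minus_distrib_mat[OF T_carrier(2) Z XDX])
  finally have eq: "T\<^sup>T * Z * T - (T\<^sup>T * X) * D * (T\<^sup>T * X)\<^sup>T = T\<^sup>T * (Z - X * D * X\<^sup>T) * T" .
  obtain R where "R \<in> carrier_mat n m" "T * R = 1\<^sub>m m" by (rule T_right_inverse)
  moreover have "Z - X * D * X\<^sup>T \<in> carrier_mat m m" by (rule minus_carrier_mat[OF XDX])
  ultimately show ?thesis using eq psd_congruence_iff[OF _ T_carrier(1)] by simp
qed

lemma L_shrunk_eq_image:
  assumes "L \<subseteq> {..<n} \<times> {..<n}"
  shows "L_shrunk m B L = (\<lambda>(i, j). (b i, b j)) ` L"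
proof (intro equalityI subsetI)
  fix x assume "x \<in> L_shrunk m B L"
  then obtain i j u v where x: "x = (i, j)" "i < m" "j < m" "u \<in> B i" "v \<in> B j" "(u, v) \<in> L"
    by (auto simp: L_shrunk_def)
  then have "x = (b u, b v)" by (simp add: mem_class_iff)
  then show "x \<in> (\<lambda>(i, j). (b i, b j)) ` L" using x(6) by force
next
  fix x assume "x \<in> (\<lambda>(i, j). (b i, b j)) ` L"
  then obtain u v where x: "x = (b u, b v)" "(u, v) \<in> L" by auto
  then have "u < n" "v < n" using assms by auto
  then have "b u < m" "b v < m" "u \<in> B (b u)" "v \<in> B (b v)"
    by (simp_all add: class_less mem_class_iff)
  then show "x \<in> L_shrunk m B L" using x by (auto simp: L_shrunk_def)
qed

lemma cannot_link_expand_iff: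
  assumes X: "X \<in> carrier_mat m k" and Z: "Z \<in> carrier_mat m m"
    and sym: "T\<^sup>T * Z * T \<in> sym_mats n" and L: "L \<subseteq> {..<n} \<times> {..<n}"
  shows "(T\<^sup>T * X, T\<^sup>T * Z * T) \<in> cannot_link_set n k L \<longleftrightarrow>
    (\<forall>h<k. \<forall>(i, j) \<in> L_shrunk m B L. X $$ (i, h) + X $$ (j, h) \<le> 1) \<and>
    (\<forall>(i, j) \<in> L_shrunk m B L. Z $$ (i, j) = 0)"
proof -
  have "T\<^sup>T * X \<in> carrier_mat n k" using X by auto
  moreover have "(\<forall>(i, j) \<in> L.
      (\<forall>h<k. (T\<^sup>T * X) $$ (i, h) + (T\<^sup>T * X) $$ (j, h) \<le> 1) \<and> (T\<^sup>T * Z * T) $$ (i, j) = 0) \<longleftrightarrow>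
    (\<forall>(i, j) \<in> L. (\<forall>h<k. X $$ (b i, h) + X $$ (b j, h) \<le> 1) \<and> Z $$ (b i, b j) = 0)"
    using L by (intro ball_cong)
      (auto simp: T_transpose_mult_entry[OF X] congruence_entry[OF Z] simp del: index_mult_mat(1))
  ultimately show ?thesis
    using sym by (auto simp: cannot_link_set_def L_shrunk_eq_image[OF L])
qed

lemma must_link_expand:
  assumes X: "X \<in> carrier_mat m k" and Z: "Z \<in> carrier_mat m m"
    and sym: "T\<^sup>T * Z * T \<in> sym_mats n" and L: "L \<subseteq> {..<n} \<times> {..<n}"
    and same: "\<And>i j. (i, j) \<in> L \<Longrightarrow> b i = b j"
  shows "(T\<^sup>T * X, T\<^sup>T * Z * T) \<in> must_link_set n k L"
proof -
  have "T\<^sup>T * X \<in> carrier_mat n k" using X by auto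
  then show ?thesis
    using sym L by (auto simp: must_link_set_def T_transpose_mult_entry[OF X] congruence_entry[OF Z]
        same simp del: index_mult_mat(1))
qed

text \<open>
  Only the must-link constraints have no counterpart in the component problem; the expanded pair
  satisfies them automatically, since \<open>b\<close> identifies linked vertices.
\<close>

lemma feasible_expand_iff:
  assumes X: "X \<in> carrier_mat m k" and Z: "Z \<in> carrier_mat m m"
    and c_pos: "\<And>j. j < k \<Longrightarrow> 0 < c j"
    and L_eq: "L_eq \<subseteq> {..<n} \<times> {..<n}" "\<And>i j. (i, j) \<in> L_eq \<Longrightarrow> b i = b j"
    and L_neq: "L_neq \<subseteq> {..<n} \<times> {..<n}"
  shows "(T\<^sup>T * X, T\<^sup>T * Z * T) \<in> feasible_A n k (size_mat k c) L_eq L_neq \<longleftrightarrow>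
    (X, Z) \<in> feasible_B m k (size_mat k c) (e_vec m n B) (L_shrunk m B L_neq)"
proof (cases "Z \<in> sym_mats m")
  case True
  let ?C = "size_mat k c" and ?D = "inv_mat (size_mat k c)"
  have D: "?D \<in> carrier_mat k k" "?C * ?D = 1\<^sub>m k" using inv_size_mat[of k c] c_pos by auto
  have dD: "diag_vec ?D \<in> carrier_vec k" using D by (simp add: diag_vec_def)
  have sym: "T\<^sup>T * Z * T \<in> sym_mats n" using True symmetric_congruence_iff[OF Z] by simp
  have TX: "T\<^sup>T * X \<in> carrier_mat n k" using X by auto
  have "M - 0\<^sub>m (k + m) (k + m) = M" if "M \<in> carrier_mat (k + m) (k + m)" for M :: "real mat"
    using that by (intro eq_matI) auto
  from this[OF four_block_carrier_mat[OF size_mat_carrier Z]]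
  have "four_block_mat ?C X\<^sup>T X Z - 0\<^sub>m (k + m) (k + m) = four_block_mat ?C X\<^sup>T X Z" .
  then have block: "four_block_mat ?C X\<^sup>T X Z \<succeq> 0\<^sub>m (k + m) (k + m) \<longleftrightarrow>
      T\<^sup>T * Z * T \<succeq> (T\<^sup>T * X) * ?D * (T\<^sup>T * X)\<^sup>T"
    using psd_block_iff_schur_complement[OF size_mat_carrier psd_size_mat D X Z]
      psd_expand_iff[OF X Z D(1)] True
    by (simp add: psd_ge_def sym_mats_def)
  have "(T\<^sup>T * X, T\<^sup>T * Z * T) \<in> assignment_set n k ?C \<longleftrightarrow>
      X *\<^sub>v ones_vec k = ones_vec m \<and> X\<^sup>T *\<^sub>v e_vec m n B = diag_vec ?C \<and>
      Z *\<^sub>v e_vec m n B = ones_vec m \<and> diag_vec Z = X *\<^sub>v diag_vec ?D \<and>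
      0\<^sub>m m k \<le> X \<and> 0\<^sub>m m m \<le> Z \<and> four_block_mat ?C X\<^sup>T X Z \<succeq> 0\<^sub>m (k + m) (k + m)"
    unfolding assignment_set_def mem_Collect_eq prod.case
      row_sums_expand_iff[OF X] column_sums_expand[OF X] congruence_row_sums_expand_iff[OF Z]
      diagonal_expand_iff[OF X Z dD] nonneg_expand_iff[OF X] nonneg_congruence_iff[OF Z] block
    using TX sym by blast
  then show ?thesis
    unfolding feasible_A_def feasible_B_def Int_iff mem_Collect_eq prod.case
      cannot_link_expand_iff[OF X Z sym L_neq]
    using must_link_expand[OF X Z sym L_eq] X True by blast
next
  case False
  then have "T\<^sup>T * Z * T \<notin> sym_mats n" using symmetric_congruence_iff[OF Z] by simp
  then show ?thesis using False by (auto simp: feasible_A_def feasible_B_def assignment_set_def)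
qed

lemma objective_expand:
  assumes W: "W \<in> carrier_mat n n" and Z: "Z \<in> carrier_mat m m"
  shows "objective_A W (T\<^sup>T * Z * T) = objective_B W T Z"
proof -
  have WT: "W * T\<^sup>T \<in> carrier_mat n m" using W by auto
  have P: "W * T\<^sup>T * Z \<in> carrier_mat n m" using WT Z by auto
  have TZ: "T\<^sup>T * Z \<in> carrier_mat n m" using Z by auto
  have WZ: "W * (T\<^sup>T * Z * T) = (W * T\<^sup>T * Z) * T"
    using W Z TZ
    by (simp add: assoc_mult_mat[OF W TZ T_carrier(1), symmetric] assoc_mult_mat[OF W T_carrier(2) Z])
  have "W * (T\<^sup>T * Z * T) \<in> carrier_mat n n" using WZ P by auto
  then have "objective_A W (T\<^sup>T * Z * T) = tr W - tr (W * (T\<^sup>T * Z * T))"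
    using W by (simp add: objective_A_def tr_def sum_subtractf del: index_mult_mat(1))
  also have "tr (W * (T\<^sup>T * Z * T)) = tr (T * (W * T\<^sup>T * Z))"
    by (simp add: WZ tr_mult_commute[OF P T_carrier(1)])
  also have "T * (W * T\<^sup>T * Z) = T * W * T\<^sup>T * Z"
    by (simp add: assoc_mult_mat[OF T_carrier(1) WT Z, symmetric]
        assoc_mult_mat[OF T_carrier(1) W T_carrier(2), symmetric])
  finally show ?thesis by (simp add: objective_B_def)
qed

end

section \<open>Constancy on connected components\<close>

lemma constant_on_paths:
  assumes "(i, j) \<in> (L \<union> L\<inverse>)\<^sup>*" and "\<And>x y. (x, y) \<in> L \<Longrightarrow> f x = f y"
  shows "f i = f j"
  using assms(1) by induction (use assms(2) in force)+

lemma connected_equiv: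
  "equiv {..<n} (Restr ((L \<union> L\<inverse>)\<^sup>*) {..<n :: nat})"
proof (rule equivI)
  have "sym ((L \<union> L\<inverse>)\<^sup>*)" by (intro sym_rtrancl) (auto simp: sym_def)
  then show "sym (Restr ((L \<union> L\<inverse>)\<^sup>*) {..<n})" by (auto simp: sym_def)
  show "trans (Restr ((L \<union> L\<inverse>)\<^sup>*) {..<n})"
    by (auto simp: trans_def intro: rtrancl_trans)
qed (auto simp: refl_on_def)

lemma components_indexed_partition:
  assumes B: "bij_betw B {..<m} (components n L)"
  obtains b r where "indexed_partition n m B b r"
    and "\<And>i j. i < n \<Longrightarrow> j < n \<Longrightarrow> b i = b j \<longleftrightarrow> (i, j) \<in> (L \<union> L\<inverse>)\<^sup>*"
proof -
  define E where "E = Restr ((L \<union> L\<inverse>)\<^sup>*) {..<n}"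
  have E: "equiv {..<n} E" unfolding E_def by (rule connected_equiv)
  define b where "b j = the_inv_into {..<m} B (E `` {j})" for j
  define r where "r i = (SOME j. j \<in> B i)" for i
  have comps: "B ` {..<m} = {..<n} // E" and inj: "inj_on B {..<m}"
    using B by (auto simp: components_def E_def bij_betw_def)
  have b: "b j < m" "B (b j) = E `` {j}" if "j < n" for j
  proof -
    have "E `` {j} \<in> B ` {..<m}" using that comps by (simp add: quotientI)
    then show "b j < m" "B (b j) = E `` {j}"
      unfolding b_def using the_inv_into_into[OF inj] f_the_inv_into_f[OF inj] by blast+
  qed
  have b_eq: "b i = b j \<longleftrightarrow> (i, j) \<in> E" if "i < n" "j < n" for i j
  proof -
    have "b i = b j \<longleftrightarrow> E `` {i} = E `` {j}"
      using b(2)[OF that(1)] b(2)[OF that(2)] by (metis b_def)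
    then show ?thesis using eq_equiv_class_iff[OF E] that by simp
  qed
  have mem: "j \<in> B i \<longleftrightarrow> j < n \<and> b j = i" if i: "i < m" for i j
  proof -
    have "B i \<in> {..<n} // E" using i comps by blast
    then obtain x where x: "x < n" "B i = E `` {x}" by (auto elim: quotientE)
    then have bx: "b x = i" using i inj by (simp add: b_def the_inv_into_f_f flip: x(2))
    have "j \<in> B i \<longleftrightarrow> j < n \<and> (x, j) \<in> E" using x by (auto simp: E_def)
    then show ?thesis using b_eq[OF x(1), of j] bx by auto
  qed
  have "r i \<in> B i" if "i < m" for i
  proof -
    have "B i \<noteq> {}" using that comps in_quotient_imp_non_empty[OF E] by blast
    then show ?thesis by (simp add: r_def some_in_eq)
  qed
  then have "indexed_partition n m B b r"
    using b(1) mem by unfold_locales auto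
  moreover have "b i = b j \<longleftrightarrow> (i, j) \<in> (L \<union> L\<inverse>)\<^sup>*" if "i < n" "j < n" for i j
    using b_eq[OF that] that by (simp add: E_def)
  ultimately show ?thesis by (rule that)
qed

text \<open>
  The must-link constraints make the rows of \<open>X\<close> and \<open>Z\<close> constant along paths, hence on every class,
  so they can be read off at the representatives.  For the columns of \<open>Z\<close> the symmetry of \<open>Z\<close> is
  essential, as the constraints speak of rows only.
\<close>

lemma (in indexed_partition) must_link_imp_expanded:
  assumes XZ: "(X, Z) \<in> must_link_set n k L"
    and path: "\<And>i j. i < n \<Longrightarrow> j < n \<Longrightarrow> b i = b j \<Longrightarrow> (i, j) \<in> (L \<union> L\<inverse>)\<^sup>*"
  obtains Xs Zs where "Xs \<in> carrier_mat m k" "Zs \<in> carrier_mat m m" "X = T\<^sup>T * Xs" "Z = T\<^sup>T * Zs * T"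
proof
  define Xs where "Xs = mat m k (\<lambda>(i, h). X $$ (r i, h))"
  define Zs where "Zs = mat m m (\<lambda>(i, j). Z $$ (r i, r j))"
  show Xs: "Xs \<in> carrier_mat m k" and Zs: "Zs \<in> carrier_mat m m" by (simp_all add: Xs_def Zs_def)
  have X: "X \<in> carrier_mat n k" and Z: "Z \<in> carrier_mat n n" and Zsym: "Z\<^sup>T = Z"
    and X_link: "\<And>i j h. (i, j) \<in> L \<Longrightarrow> h < k \<Longrightarrow> X $$ (i, h) = X $$ (j, h)"
    and Z_link: "\<And>i j h. (i, j) \<in> L \<Longrightarrow> h < n \<Longrightarrow> Z $$ (i, h) = Z $$ (j, h)"
    using XZ by (auto simp: must_link_set_def sym_mats_def)
  have rep: "r (b j) < n" "(j, r (b j)) \<in> (L \<union> L\<inverse>)\<^sup>*" if "j < n" for j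
    using that class_less rep_less class_rep path by auto
  have X_rep: "X $$ (j, h) = X $$ (r (b j), h)" if "j < n" "h < k" for j h
    using constant_on_paths[OF rep(2)[OF that(1)], of "\<lambda>x. X $$ (x, h)"] X_link that by blast
  have Z_rep: "Z $$ (j, h) = Z $$ (r (b j), h)" if "j < n" "h < n" for j h
    using constant_on_paths[OF rep(2)[OF that(1)], of "\<lambda>x. Z $$ (x, h)"] Z_link that by blast
  have Z_swap: "Z $$ (i, j) = Z $$ (j, i)" if "i < n" "j < n" for i j
    using arg_cong[OF Zsym, of "\<lambda>M. M $$ (i, j)"] Z that by simp
  show "X = T\<^sup>T * Xs"
  proof (rule eq_matI)
    fix j h assume "j < dim_row (T\<^sup>T * Xs)" "h < dim_col (T\<^sup>T * Xs)"
    then have jh: "j < n" "h < k" using Xs by auto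
    show "X $$ (j, h) = (T\<^sup>T * Xs) $$ (j, h)"
      unfolding T_transpose_mult_entry[OF Xs jh]
      using class_less[OF jh(1)] jh X_rep[OF jh] by (simp add: Xs_def)
  qed (use X Xs in auto)
  show "Z = T\<^sup>T * Zs * T"
  proof (rule eq_matI)
    fix i j assume "i < dim_row (T\<^sup>T * Zs * T)" "j < dim_col (T\<^sup>T * Zs * T)"
    then have ij: "i < n" "j < n" by auto
    have "Z $$ (i, j) = Z $$ (r (b i), r (b j))"
      using Z_rep Z_swap rep ij by metis
    then show "Z $$ (i, j) = (T\<^sup>T * Zs * T) $$ (i, j)"
      unfolding congruence_entry[OF Zs ij] using class_less ij by (simp add: Zs_def)
  qed (use Z in auto)
qed

section \<open>Equivalence of the two problems\<close>

theorem theorem7: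
  fixes n k d m :: nat
    and p :: "nat \<Rightarrow> real vec"
    and c :: "nat \<Rightarrow> nat"
    and L_eq L_neq :: "(nat \<times> nat) set"
    and B :: "nat \<Rightarrow> nat set"
    and W C T :: "real mat"
    and e :: "real vec"
    and L_s :: "(nat \<times> nat) set"
  assumes points: "\<And>i. i < n \<Longrightarrow> p i \<in> carrier_vec d"
    and W: "W = gram_mat n p"
    and c_pos: "\<And>j. j < k \<Longrightarrow> 0 < c j"
    and c_sum: "(\<Sum>j<k. c j) = n"
    and C: "C = size_mat k c"
    and L_eq: "L_eq \<subseteq> {..<n} \<times> {..<n}"
    and L_neq: "L_neq \<subseteq> {..<n} \<times> {..<n}"
    and B: "bij_betw B {..<m} (components n L_eq)"
    and T: "T = T_mat m n B"
    and e: "e = e_vec m n B"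
    and L_s: "L_s = L_shrunk m B L_neq"
  shows "(\<forall>(X, Z) \<in> feasible_A n k C L_eq L_neq.
            \<exists>(Xs, Zs) \<in> feasible_B m k C e L_s. objective_B W T Zs = objective_A W Z) \<and>
         (\<forall>(Xs, Zs) \<in> feasible_B m k C e L_s.
            \<exists>(X, Z) \<in> feasible_A n k C L_eq L_neq. objective_A W Z = objective_B W T Zs)"
proof -
  obtain b r where "indexed_partition n m B b r"
    and path: "\<And>i j. i < n \<Longrightarrow> j < n \<Longrightarrow> b i = b j \<longleftrightarrow> (i, j) \<in> (L_eq \<union> L_eq\<inverse>)\<^sup>*"
    using components_indexed_partition[OF B] by blast
  then interpret P: indexed_partition n m B b r by simp
  have W_carrier: "W \<in> carrier_mat n n" by (simp add: W gram_mat_def)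
  have same: "b i = b j" if "(i, j) \<in> L_eq" for i j
    using that L_eq path[of i j] by blast
  have feasible: "(T\<^sup>T * Xs, T\<^sup>T * Zs * T) \<in> feasible_A n k C L_eq L_neq \<longleftrightarrow>
      (Xs, Zs) \<in> feasible_B m k C e L_s"
    and objective: "objective_A W (T\<^sup>T * Zs * T) = objective_B W T Zs"
    if "Xs \<in> carrier_mat m k" "Zs \<in> carrier_mat m m" for Xs Zs
    using P.feasible_expand_iff[where c = c, OF that c_pos L_eq same L_neq]
      P.objective_expand[OF W_carrier that(2)]
    by (simp_all add: T C e L_s)
  show ?thesis
  proof (intro conjI ballI; clarify)
    fix X Z assume XZ: "(X, Z) \<in> feasible_A n k C L_eq L_neq"
    then have "(X, Z) \<in> must_link_set n k L_eq" by (simp add: feasible_A_def)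
    then obtain Xs Zs where s: "Xs \<in> carrier_mat m k" "Zs \<in> carrier_mat m m"
      "X = T\<^sup>T * Xs" "Z = T\<^sup>T * Zs * T"
      unfolding T using P.must_link_imp_expanded path by metis
    show "\<exists>(Xs, Zs) \<in> feasible_B m k C e L_s. objective_B W T Zs = objective_A W Z"
      using feasible[OF s(1,2)] objective[OF s(1,2)] XZ s(3,4)
      by (intro bexI[of _ "(Xs, Zs)"]) auto
  next
    fix Xs Zs assume XZs: "(Xs, Zs) \<in> feasible_B m k C e L_s"
    then have s: "Xs \<in> carrier_mat m k" "Zs \<in> carrier_mat m m"
      by (auto simp: feasible_B_def sym_mats_def)
    show "\<exists>(X, Z) \<in> feasible_A n k C L_eq L_neq. objective_A W Z = objective_B W T Zs"
      using feasible[OF s] objective[OF s] XZs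
      by (intro bexI[of _ "(T\<^sup>T * Xs, T\<^sup>T * Zs * T)"]) auto
  qed
qed

end
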